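(* Let $M\in\mathbb R^{n\times n}$ have $n$ distinct eigenvalues. Let $S_*\in\mathbb C^{n\times n}$ be any invertible matrix such that $M=S_*D_*S_*^{-1}$ for some diagonal matrix $D_*$, and let $K\in\mathbb R^{n\times n}$ be the diagonal matrix with diagonal entries $K_{ii}=\sum_{j=1}^n\left|[S_*^{-1}]_{ij}\right|$. Then $$\min_{M=SDS^{-1}}\|S\|_\infty\,\|S^{-1}\|_\infty=\|S_*K\|_\infty,$$ where the minimum is taken over all invertible matrices $S\in\mathbb C^{n\times n}$ for which $M=SDS^{-1}$ with some diagonal matrix $D$ (in particular, the minimum is attained).
   Context: For a matrix $C\in\mathbb C^{n\times n}$, $\|C\|_\infty$ denotes the matrix norm induced by the vector norm $\|x\|_\infty=\max_i|x_i|$, i.e. $\|C\|_\infty=\max_i\sum_{j=1}^n|C_{ij}|$. *)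

theory Defs
  imports "HOL-Analysis.Analysis"
begin

abbreviation cmatrix :: "real^'n^'m \<Rightarrow> complex^'n^'m" where
  "cmatrix \<equiv> map_matrix complex_of_real"

definition diagonal_matrix :: "'a::zero^'n^'n \<Rightarrow> bool" where
  "diagonal_matrix D \<longleftrightarrow> (\<forall>i j. i \<noteq> j \<longrightarrow> D $ i $ j = 0)"

definition eigenvalues :: "'a::field^'n^'n \<Rightarrow> 'a set" where
  "eigenvalues A = {l. \<exists>v. v \<noteq> 0 \<and> A *v v = l *s v}"

definition diagonalizes :: "'a::field^'n^'n \<Rightarrow> 'a^'n^'n \<Rightarrow> bool" where
  "diagonalizes S A \<longleftrightarrow>
     invertible S \<and> (\<exists>D. diagonal_matrix D \<and> A = S ** D ** matrix_inv S)"

text \<open>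
  The library's \<^const>\<open>infnorm\<close> is not the maximum norm on complex vectors: it takes the maximum
  over real and imaginary parts separately.
\<close>

definition vec_norm_inf :: "complex^'n \<Rightarrow> real" where
  "vec_norm_inf x = (MAX i. cmod (x $ i))"

definition mat_norm_inf :: "complex^'n^'n \<Rightarrow> real" where
  "mat_norm_inf C = (SUP x\<in>{x. vec_norm_inf x = 1}. vec_norm_inf (C *v x))"

lemma mat_norm_inf_eq_max_row_sum:
  fixes C :: "complex^'n^'n"
  shows "mat_norm_inf C = (MAX i. \<Sum>j\<in>UNIV. cmod (C $ i $ j))"
proof -
  let ?r = "\<lambda>i. \<Sum>j\<in>UNIV. cmod (C $ i $ j)"
  have upper: "vec_norm_inf (C *v x) \<le> Max (range ?r)" if "vec_norm_inf x = 1" for x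
  proof -
    have x: "cmod (x $ j) \<le> 1" for j
      using that Max_ge[of "range (\<lambda>i. cmod (x $ i))" "cmod (x $ j)"]
      by (simp add: vec_norm_inf_def)
    have "cmod ((C *v x) $ i) \<le> Max (range ?r)" for i
    proof -
      have "cmod ((C *v x) $ i) \<le> (\<Sum>j\<in>UNIV. cmod (C $ i $ j * x $ j))"
        by (simp add: matrix_vector_mult_def norm_sum)
      also have "\<dots> \<le> ?r i"
        using x by (intro sum_mono) (simp add: norm_mult mult_left_le)
      also have "\<dots> \<le> Max (range ?r)" by simp
      finally show ?thesis .
    qed
    then show ?thesis by (simp add: vec_norm_inf_def)
  qed
  have "Max (range ?r) \<in> range ?r" by (rule Max_in) auto
  then obtain i where i: "Max (range ?r) = ?r i" by (rule imageE)
  define x :: "complex^'n" where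
    "x = (\<chi> j. if C $ i $ j = 0 then 1 else cnj (sgn (C $ i $ j)))"
  have "cmod (x $ j) = 1" for j by (simp add: x_def norm_sgn)
  then have x: "vec_norm_inf x = 1" by (simp add: vec_norm_inf_def)
  have "C $ i $ j * x $ j = of_real (cmod (C $ i $ j))" for j
    by (simp add: x_def sgn_eq complex_norm_square[symmetric] power2_eq_square)
  then have "(C *v x) $ i = of_real (?r i)"
    by (simp add: matrix_vector_mult_def)
  then have "cmod ((C *v x) $ i) = ?r i"
    by (simp only: norm_of_real) (simp add: sum_nonneg)
  moreover have "cmod ((C *v x) $ i) \<le> vec_norm_inf (C *v x)"
    by (simp add: vec_norm_inf_def)
  ultimately have "?r i \<le> vec_norm_inf (C *v x)" by simp
  with i upper[OF x] have "vec_norm_inf (C *v x) = Max (range ?r)" by simp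
  with x upper show ?thesis
    unfolding mat_norm_inf_def by (intro cSup_eq_maximum) (auto intro: rev_image_eqI)
qed

end

theory Submission
  imports Defs
begin

text \<open>
  If \<open>S\<close> also diagonalizes \<open>M\<close>, then \<open>T = S\<^sub>0\<^sup>-\<^sup>1 S\<close> intertwines two diagonal matrices, the first with
  distinct entries, so every column of \<open>T\<close> has at most one nonzero entry. There is thus no
  cancellation in \<open>S = S\<^sub>0 T\<close>, and the row sums of \<open>\<bar>S\<^sub>0\<bar> K\<close> are bounded by those of \<open>\<bar>S\<bar>\<close> weighted by
  the row sums of \<open>\<bar>S\<^sup>-\<^sup>1\<bar>\<close>. Equality holds for \<open>S = S\<^sub>0 K\<close>, all row sums of \<open>\<bar>S\<^sup>-\<^sup>1\<bar>\<close> being \<open>1\<close>.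
\<close>

lemma
  fixes A :: "'a::semiring_1^'n^'m"
  assumes "invertible A"
  shows matrix_inv_right: "A ** matrix_inv A = mat 1"
    and matrix_inv_left: "matrix_inv A ** A = mat 1"
  using someI_ex[OF assms[unfolded invertible_def]] by (simp_all add: matrix_inv_def)

text \<open>For square matrices over a field a left inverse is two-sided, so checking a single
  product identifies the inverse.\<close>

lemma matrix_inv_unique:
  fixes A B :: "'a::field^'n^'n"
  assumes "B ** A = mat 1"
  shows "invertible A" "matrix_inv A = B"
proof -
  show inv: "invertible A"
    using assms by (auto simp: invertible_left_inverse)
  have "B ** A ** matrix_inv A = B"
    by (metis inv matrix_inv_right matrix_mul_assoc matrix_mul_rid)
  then show "matrix_inv A = B" by (simp add: assms)
qed

lemma diagonal_matrix_mult_nth: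
  fixes A D :: "'a::comm_semiring_1^'n^'n"
  assumes "diagonal_matrix D"
  shows "(D ** A) $ i $ j = D $ i $ i * A $ i $ j"
    and "(A ** D) $ i $ j = A $ i $ j * D $ j $ j"
proof -
  have "(D ** A) $ i $ j = (\<Sum>k\<in>UNIV. if k = i then D $ i $ i * A $ i $ j else 0)"
    using assms unfolding matrix_matrix_mult_def diagonal_matrix_def vec_lambda_beta
      by (intro sum.cong) auto
  then show "(D ** A) $ i $ j = D $ i $ i * A $ i $ j" by simp
  have "(A ** D) $ i $ j = (\<Sum>k\<in>UNIV. if k = j then A $ i $ j * D $ j $ j else 0)"
    using assms unfolding matrix_matrix_mult_def diagonal_matrix_def vec_lambda_beta
      by (intro sum.cong) auto
  then show "(A ** D) $ i $ j = A $ i $ j * D $ j $ j" by simp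
qed

lemma diagonal_matrix_mult_vec_nth:
  fixes D :: "'a::comm_semiring_1^'n^'n"
  assumes "diagonal_matrix D"
  shows "(D *v x) $ i = D $ i $ i * x $ i"
proof -
  have "(D *v x) $ i = (\<Sum>k\<in>UNIV. if k = i then D $ i $ i * x $ i else 0)"
    using assms unfolding matrix_vector_mult_def diagonal_matrix_def vec_lambda_beta
      by (intro sum.cong) auto
  then show ?thesis by simp
qed

lemma row_sum_le_mat_norm_inf: "(\<Sum>j\<in>UNIV. cmod (C $ i $ j)) \<le> mat_norm_inf C"
  by (simp add: mat_norm_inf_eq_max_row_sum)

lemma mat_norm_inf_leI:
  "(\<And>i. (\<Sum>j\<in>UNIV. cmod (C $ i $ j)) \<le> b) \<Longrightarrow> mat_norm_inf C \<le> b"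
  by (simp add: mat_norm_inf_eq_max_row_sum)

text \<open>In the basis of columns of \<open>S\<close> an eigenvector becomes an eigenvector of
  \<open>D\<close>, and any nonzero coordinate of it pins down the eigenvalue. This inclusion is
  enough for the counting argument that forces the diagonal entries to be distinct.\<close>

lemma eigenvalues_similar_diagonal:
  fixes S D :: "'a::field^'n^'n"
  assumes "invertible S" "diagonal_matrix D"
  shows "eigenvalues (S ** D ** matrix_inv S) \<subseteq> range (\<lambda>i. D $ i $ i)"
proof
  fix l assume "l \<in> eigenvalues (S ** D ** matrix_inv S)"
  then obtain v where v: "v \<noteq> 0" "(S ** D ** matrix_inv S) *v v = l *s v"
    by (auto simp: eigenvalues_def)
  define w where "w = matrix_inv S *v v"
  have Sw: "S *v w = v"
    by (simp add: w_def matrix_vector_mul_assoc matrix_inv_right assms(1))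
  with v(1) have "w \<noteq> 0" by auto
  then obtain i where i: "w $ i \<noteq> 0" by (auto simp: vec_eq_iff)
  have "D *v w = matrix_inv S *v ((S ** D ** matrix_inv S) *v v)"
    by (simp add: w_def matrix_vector_mul_assoc matrix_mul_assoc matrix_inv_left assms(1))
  also have "\<dots> = l *s w"
    by (simp add: v(2) w_def vector_scalar_commute)
  finally have "D $ i $ i * w $ i = l * w $ i"
    by (metis assms(2) diagonal_matrix_mult_vec_nth vector_smult_component)
  with i show "l \<in> range (\<lambda>i. D $ i $ i)" by auto
qed

text \<open>Comparing the entries at row \<open>l\<close> and column \<open>k\<close> in
  \<open>D ** T = T ** E\<close>, a nonzero \<open>T $ l $ k\<close> cancels and leaves
  \<open>D $ l $ l = E $ k $ k\<close>. Distinct diagonal entries of \<open>D\<close> allow only one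
  such \<open>l\<close>.\<close>

lemma diagonal_intertwiner_column:
  fixes D E T :: "'a::field^'n^'n"
  assumes "diagonal_matrix D" "diagonal_matrix E" "inj (\<lambda>i. D $ i $ i)" "D ** T = T ** E"
    and "T $ i $ k \<noteq> 0" "T $ j $ k \<noteq> 0"
  shows "i = j"
proof -
  have "D $ l $ l = E $ k $ k" if "T $ l $ k \<noteq> 0" for l
    using assms(4) that diagonal_matrix_mult_nth(1)[OF assms(1), of T l k]
      diagonal_matrix_mult_nth(2)[OF assms(2), of T l k] by simp
  with assms(5,6) have "D $ i $ i = D $ j $ j" by simp
  with assms(3) show ?thesis by (rule injD)
qed

lemma norm_sum_single_nonzero:
  fixes f :: "'a::finite \<Rightarrow> 'b::real_normed_vector"
  assumes "\<And>i j. f i \<noteq> 0 \<Longrightarrow> f j \<noteq> 0 \<Longrightarrow> i = j"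
  shows "norm (\<Sum>i\<in>UNIV. f i) = (\<Sum>i\<in>UNIV. norm (f i))"
proof (cases "\<exists>i. f i \<noteq> 0")
  case True
  then obtain i where "f i \<noteq> 0" by blast
  then have "f j = 0" if "j \<noteq> i" for j using assms that by blast
  then have "f = (\<lambda>j. if j = i then f i else 0)" by auto
  \<comment> \<open>Naming the value \<open>c\<close> removes \<open>f\<close> from the right-hand
    side; rewriting with the previous equation would loop.\<close>
  then obtain c where "f = (\<lambda>j. if j = i then c else 0)" by blast
  then show ?thesis by (simp add: if_distrib cong: if_cong)
qed simp

lemma mat_norm_inf_le_diagonalizer:
  fixes M S S\<^sub>0 K :: "complex^'n^'n"
  assumes "card (eigenvalues M) = CARD('n)" "diagonalizes S\<^sub>0 M" "diagonalizes S M"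
    and K: "diagonal_matrix K"
      "\<And>i. K $ i $ i = of_real (\<Sum>j\<in>UNIV. cmod (matrix_inv S\<^sub>0 $ i $ j))"
  shows "mat_norm_inf (S\<^sub>0 ** K) \<le> mat_norm_inf S * mat_norm_inf (matrix_inv S)"
proof -
  obtain D where D: "invertible S\<^sub>0" "diagonal_matrix D" "M = S\<^sub>0 ** D ** matrix_inv S\<^sub>0"
    using assms(2) by (auto simp: diagonalizes_def)
  obtain E where E: "invertible S" "diagonal_matrix E" "M = S ** E ** matrix_inv S"
    using assms(3) by (auto simp: diagonalizes_def)
  \<comment> \<open>All \<open>CARD('n)\<close> eigenvalues occur among the diagonal entries of
    \<open>D\<close>, so no entry can repeat.\<close>
  have "CARD('n) \<le> card (range (\<lambda>i. D $ i $ i))"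
    using card_mono[OF _ eigenvalues_similar_diagonal[OF D(1,2)]] assms(1) D(3) by simp
  then have inj: "inj (\<lambda>i. D $ i $ i)"
    by (intro eq_card_imp_inj_on antisym card_image_le) auto
  \<comment> \<open>Column \<open>k\<close> of \<open>T\<close> holds the coordinates of column
    \<open>k\<close> of \<open>S\<close> in the basis of columns of
    \<open>S\<^sub>0\<close>.\<close>
  define T where "T = matrix_inv S\<^sub>0 ** S"
  have S: "S = S\<^sub>0 ** T"
    by (simp add: T_def matrix_mul_assoc matrix_inv_right D(1))
  have inv: "matrix_inv S\<^sub>0 = T ** matrix_inv S"
    by (simp add: T_def matrix_mul_assoc[symmetric] matrix_inv_right E(1))
  have "D ** T = matrix_inv S\<^sub>0 ** (S\<^sub>0 ** D ** matrix_inv S\<^sub>0) ** S"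
    by (simp add: T_def matrix_mul_assoc matrix_inv_left D(1))
  also have "\<dots> = matrix_inv S\<^sub>0 ** (S ** E ** matrix_inv S) ** S"
    using D(3) E(3) by simp
  also have "\<dots> = matrix_inv S\<^sub>0 ** S ** E ** (matrix_inv S ** S)"
    by (simp only: matrix_mul_assoc)
  also have "\<dots> = T ** E"
    by (simp add: T_def matrix_inv_left E(1))
  finally have DT: "D ** T = T ** E" .
  define r where "r k = (\<Sum>j\<in>UNIV. cmod (matrix_inv S $ k $ j))" for k
  \<comment> \<open>The triangle inequality, applied to row \<open>l\<close> of
    \<open>matrix_inv S\<^sub>0 = T ** matrix_inv S\<close>.\<close>
  have K_le: "cmod (K $ l $ l) \<le> (\<Sum>k\<in>UNIV. cmod (T $ l $ k) * r k)" for l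
  proof -
    have "cmod (K $ l $ l) = (\<Sum>j\<in>UNIV. cmod (\<Sum>k\<in>UNIV. T $ l $ k * matrix_inv S $ k $ j))"
      unfolding K(2) norm_of_real by (simp add: inv matrix_matrix_mult_def sum_nonneg)
    also have "\<dots> \<le> (\<Sum>j\<in>UNIV. \<Sum>k\<in>UNIV. cmod (T $ l $ k) * cmod (matrix_inv S $ k $ j))"
      by (intro sum_mono order.trans[OF norm_sum]) (simp add: norm_mult)
    also have "\<dots> = (\<Sum>k\<in>UNIV. cmod (T $ l $ k) * r k)"
      by (subst sum.swap) (simp add: r_def sum_distrib_left)
    finally show ?thesis .
  qed
  \<comment> \<open>Here the triangle inequality is an equality: column \<open>k\<close> of
    \<open>T\<close> has at most one nonzero entry, so the sum has at most one nonzero term.\<close>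
  have S_nth: "cmod (S $ i $ k) = (\<Sum>l\<in>UNIV. cmod (S\<^sub>0 $ i $ l) * cmod (T $ l $ k))" for i k
  proof -
    have "cmod (S $ i $ k) = cmod (\<Sum>l\<in>UNIV. S\<^sub>0 $ i $ l * T $ l $ k)"
      by (simp add: S matrix_matrix_mult_def)
    also have "\<dots> = (\<Sum>l\<in>UNIV. cmod (S\<^sub>0 $ i $ l * T $ l $ k))"
      by (rule norm_sum_single_nonzero)
        (auto intro: diagonal_intertwiner_column[OF D(2) E(2) inj DT])
    finally show ?thesis by (simp add: norm_mult)
  qed
  show ?thesis
  proof (rule mat_norm_inf_leI)
    fix i
    have "(\<Sum>l\<in>UNIV. cmod ((S\<^sub>0 ** K) $ i $ l)) = (\<Sum>l\<in>UNIV. cmod (S\<^sub>0 $ i $ l) * cmod (K $ l $ l))"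
      by (simp add: diagonal_matrix_mult_nth(2)[OF K(1)] norm_mult)
    also have "\<dots> \<le> (\<Sum>l\<in>UNIV. cmod (S\<^sub>0 $ i $ l) * (\<Sum>k\<in>UNIV. cmod (T $ l $ k) * r k))"
      by (intro sum_mono mult_left_mono K_le) simp
    \<comment> \<open>After exchanging the sums, the inner sum over \<open>l\<close> is exactly the
      right-hand side of \<open>S_nth\<close>.\<close>
    also have "\<dots> = (\<Sum>k\<in>UNIV. cmod (S $ i $ k) * r k)"
      unfolding S_nth sum_distrib_left sum_distrib_right
      by (subst sum.swap) (simp add: mult.assoc)
    also have "\<dots> \<le> (\<Sum>k\<in>UNIV. cmod (S $ i $ k) * mat_norm_inf (matrix_inv S))"
      unfolding r_def by (intro sum_mono mult_left_mono row_sum_le_mat_norm_inf) simp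
    also have "\<dots> = (\<Sum>k\<in>UNIV. cmod (S $ i $ k)) * mat_norm_inf (matrix_inv S)"
      by (simp add: sum_distrib_right)
    also have "\<dots> \<le> mat_norm_inf S * mat_norm_inf (matrix_inv S)"
      \<comment> \<open>The side condition that the norm of \<open>matrix_inv S\<close> is
        nonnegative follows since it dominates a row sum of absolute values.\<close>
      by (intro mult_right_mono row_sum_le_mat_norm_inf
          order.trans[OF _ row_sum_le_mat_norm_inf] sum_nonneg) simp
    finally show "(\<Sum>l\<in>UNIV. cmod ((S\<^sub>0 ** K) $ i $ l)) \<le> mat_norm_inf S * mat_norm_inf (matrix_inv S)" .
  qed
qed

text \<open>A zero row of \<open>A\<close> would put a zero on the diagonal of the identity. Applied
  to \<open>matrix_inv S\<^sub>0\<close>, this makes the diagonal of \<open>K\<close>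
  positive.\<close>

lemma invertible_row_nonzero:
  fixes A :: "'a::field^'n^'n"
  assumes "invertible A"
  shows "\<exists>j. A $ i $ j \<noteq> 0"
proof (rule ccontr)
  assume "\<not> ?thesis"
  then have "(A ** matrix_inv A) $ i $ i = 0"
    by (simp add: matrix_matrix_mult_def)
  then show False by (simp add: matrix_inv_right assms mat_def)
qed

text \<open>Scaling the columns of \<open>S\<^sub>0\<close> only rescales eigenvectors, while each
  row of the inverse gets divided by its own absolute sum.\<close>

lemma diagonalizer_row_scaling:
  fixes M S\<^sub>0 K :: "complex^'n^'n"
  assumes "diagonalizes S\<^sub>0 M" and K: "diagonal_matrix K"
    "\<And>i. K $ i $ i = of_real (\<Sum>j\<in>UNIV. cmod (matrix_inv S\<^sub>0 $ i $ j))"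
  shows "diagonalizes (S\<^sub>0 ** K) M" and "mat_norm_inf (matrix_inv (S\<^sub>0 ** K)) = 1"
proof -
  obtain D where D: "invertible S\<^sub>0" "diagonal_matrix D" "M = S\<^sub>0 ** D ** matrix_inv S\<^sub>0"
    using assms(1) by (auto simp: diagonalizes_def)
  have "invertible (matrix_inv S\<^sub>0)"
    using D(1) by (metis invertible_def matrix_inv_left matrix_inv_right)
  have pos: "(\<Sum>j\<in>UNIV. cmod (matrix_inv S\<^sub>0 $ i $ j)) > 0" for i
  proof -
    obtain j where "matrix_inv S\<^sub>0 $ i $ j \<noteq> 0"
      using invertible_row_nonzero[OF \<open>invertible (matrix_inv S\<^sub>0)\<close>] by blast
    then show ?thesis by (intro sum_pos2[of _ j]) auto
  qed
  then have nz: "K $ i $ i \<noteq> 0" for i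
    unfolding K(2) of_real_eq_0_iff by (metis less_irrefl)
  \<comment> \<open>\<open>L\<close> is the inverse of \<open>K\<close>, written out so that its
    entries are available for the row sums.\<close>
  define L :: "complex^'n^'n" where "L = (\<chi> i j. if i = j then inverse (K $ i $ i) else 0)"
  have L: "diagonal_matrix L" by (simp add: L_def diagonal_matrix_def)
  have KL: "K ** L = mat 1" "L ** K = mat 1"
    using nz K(1) by (auto simp: vec_eq_iff diagonal_matrix_mult_nth(1)[OF K(1)]
        diagonal_matrix_mult_nth(2)[OF K(1)] L_def mat_def)
  have "L ** matrix_inv S\<^sub>0 ** (S\<^sub>0 ** K) = L ** (matrix_inv S\<^sub>0 ** S\<^sub>0) ** K"
    by (simp only: matrix_mul_assoc)
  also have "\<dots> = mat 1" by (simp add: matrix_inv_left D(1) KL)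
  finally have "L ** matrix_inv S\<^sub>0 ** (S\<^sub>0 ** K) = mat 1" .
  note inv = matrix_inv_unique[OF this]
  have "K ** D = D ** K"
    by (simp add: vec_eq_iff diagonal_matrix_mult_nth[OF D(2)])
      (use K(1) in \<open>metis diagonal_matrix_def mult.commute mult_zero_left\<close>)
  then have "S\<^sub>0 ** K ** D ** (L ** matrix_inv S\<^sub>0) = S\<^sub>0 ** D ** (K ** L) ** matrix_inv S\<^sub>0"
    by (metis matrix_mul_assoc)
  then have "S\<^sub>0 ** K ** D ** matrix_inv (S\<^sub>0 ** K) = M"
    by (simp add: inv(2) KL D(3))
  then show "diagonalizes (S\<^sub>0 ** K) M"
    using inv(1) D(2) unfolding diagonalizes_def by metis
  have "(\<Sum>j\<in>UNIV. cmod ((L ** matrix_inv S\<^sub>0) $ i $ j)) = 1" for i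
  proof -
    have "(\<Sum>j\<in>UNIV. cmod ((L ** matrix_inv S\<^sub>0) $ i $ j))
        = cmod (inverse (K $ i $ i)) * (\<Sum>j\<in>UNIV. cmod (matrix_inv S\<^sub>0 $ i $ j))"
      by (simp add: diagonal_matrix_mult_nth(1)[OF L] norm_mult sum_distrib_left)
        (simp add: L_def)
    also have "cmod (inverse (K $ i $ i)) = inverse (\<Sum>j\<in>UNIV. cmod (matrix_inv S\<^sub>0 $ i $ j))"
      using pos[of i] unfolding K(2) norm_inverse norm_of_real by simp
    finally show ?thesis using pos[of i] by simp
  qed
  then show "mat_norm_inf (matrix_inv (S\<^sub>0 ** K)) = 1"
    by (simp add: mat_norm_inf_eq_max_row_sum inv(2))
qed

theorem lemma2:
  fixes M K :: "real^'n^'n" and S\<^sub>0 :: "complex^'n^'n"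
  assumes "card (eigenvalues (cmatrix M)) = CARD('n)"
    and "diagonalizes S\<^sub>0 (cmatrix M)"
    and "diagonal_matrix K"
    and "\<And>i. K $ i $ i = (\<Sum>j\<in>UNIV. cmod (matrix_inv S\<^sub>0 $ i $ j))"
  shows "(\<exists>S. diagonalizes S (cmatrix M) \<and>
            mat_norm_inf S * mat_norm_inf (matrix_inv S) = mat_norm_inf (S\<^sub>0 ** cmatrix K)) \<and>
         (\<forall>S. diagonalizes S (cmatrix M) \<longrightarrow>
            mat_norm_inf (S\<^sub>0 ** cmatrix K) \<le> mat_norm_inf S * mat_norm_inf (matrix_inv S))"
proof -
  have K: "diagonal_matrix (cmatrix K)"
    "\<And>i. cmatrix K $ i $ i = of_real (\<Sum>j\<in>UNIV. cmod (matrix_inv S\<^sub>0 $ i $ j))"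
    using assms(3,4) by (simp_all add: diagonal_matrix_def map_matrix_def)
  \<comment> \<open>The minimum is attained at \<open>S\<^sub>0 ** cmatrix K\<close>: the norm of
    its inverse is 1, so the product reduces to its own norm.\<close>
  show ?thesis
    using diagonalizer_row_scaling[OF assms(2) K]
      mat_norm_inf_le_diagonalizer[OF assms(1,2) _ K] by (metis mult.right_neutral)
qed

end
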